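(* $R(3,2) = \frac{3}{2}$, where $R(k,\ell)$ denotes the generalized repetition threshold for a $k$-letter alphabet and length parameter $\ell$.
   Context: Words are finite or (one-sided) infinite sequences of letters over a finite alphabet; a factor of a word is a contiguous finite subword; $|w|$ denotes the length of a finite word $w$. Let $\alpha>1$ be a rational number and $\ell\ge 1$ an integer. A finite word $w$ is an $(\alpha,\ell)$-repetition (a repetition of order $\alpha$ and length $\ell$) if it can be written as $w=x^n x'$, where $n$ is a positive integer, $x'$ is a (possibly empty) prefix of $x$, $|x|=\ell$, and $|w|=\alpha|x|$. For a real number $\alpha$ and an integer $\ell\ge 1$, a word is $(\alpha,\ell)$-free if it contains no factor that is an $(\alpha',\ell')$-repetition for any rational $\alpha'>1$ with $\alpha'\ge\alpha$ and any integer $\ell'\ge\ell$. A word is $(\alpha^+,\ell)$-free if it is $(\alpha',\ell)$-free for all $\alpha'>\alpha$. For integers $k\ge 2$ and $\ell\ge 1$, the generalized repetition threshold $R(k,\ell)$ is the real number $\alpha$ such that either (a) over a $k$-letter alphabet there exists an $(\alpha^+,\ell)$-free infinite word, but all $(\alpha,\ell)$-free words are finite; or (b) over a $k$-letter alphabet there exists an $(\alpha,\ell)$-free infinite word, but for all $\epsilon>0$, all $(\alpha-\epsilon,\ell)$-free words are finite. *)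

theory Defs
  imports Complex_Main "HOL-Library.Sublist"
begin

datatype 'a word = is_Fin: Fin "'a list" | is_Inf: Inf "nat \<Rightarrow> 'a"

fun letters :: "'a word \<Rightarrow> 'a set" where
  "letters (Fin u) = set u"
| "letters (Inf f) = range f"

fun factors :: "'a word \<Rightarrow> 'a list set" where
  "factors (Fin u) = {v. sublist v u}"
| "factors (Inf f) = {map f [i..<j] | i j. True}"

definition is_repetition :: "rat \<Rightarrow> nat \<Rightarrow> 'a list \<Rightarrow> bool" where
  "is_repetition \<alpha> l w \<longleftrightarrow>
     \<alpha> > 1 \<and> l \<ge> 1 \<and>
     (\<exists>n x x'. n \<ge> 1 \<and> w = concat (replicate n x) @ x' \<and> prefix x' x \<and>
        length x = l \<and> of_nat (length w) = \<alpha> * of_nat (length x))"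

definition rep_free :: "real \<Rightarrow> nat \<Rightarrow> 'a word \<Rightarrow> bool" where
  "rep_free \<alpha> l w \<longleftrightarrow>
     (\<forall>\<alpha>' l'. of_rat \<alpha>' \<ge> \<alpha> \<longrightarrow> l' \<ge> l \<longrightarrow> (\<forall>u\<in>factors w. \<not> is_repetition \<alpha>' l' u))"

definition rep_free_plus :: "real \<Rightarrow> nat \<Rightarrow> 'a word \<Rightarrow> bool" where
  "rep_free_plus \<alpha> l w \<longleftrightarrow> (\<forall>\<alpha>'>\<alpha>. rep_free \<alpha>' l w)"

text \<open>The alphabet with \<open>k\<close> letters is taken to be \<open>{..<k}\<close>.\<close>

definition words_over :: "nat \<Rightarrow> nat word set" where
  "words_over k = {w. letters w \<subseteq> {..<k}}"

definition is_gen_rep_threshold :: "nat \<Rightarrow> nat \<Rightarrow> real \<Rightarrow> bool" where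
  "is_gen_rep_threshold k l \<alpha> \<longleftrightarrow>
     ((\<exists>w\<in>words_over k. is_Inf w \<and> rep_free_plus \<alpha> l w) \<and>
      (\<forall>w\<in>words_over k. rep_free \<alpha> l w \<longrightarrow> is_Fin w)) \<or>
     ((\<exists>w\<in>words_over k. is_Inf w \<and> rep_free \<alpha> l w) \<and>
      (\<forall>\<epsilon>>0. \<forall>w\<in>words_over k. rep_free (\<alpha> - \<epsilon>) l w \<longrightarrow> is_Fin w))"

text \<open>At most one \<open>\<alpha>\<close> satisfies the predicate, because \<^const>\<open>rep_free\<close> is monotone in its
  first argument. The value below is meant for \<open>k \<ge> 2\<close> and \<open>l \<ge> 1\<close>, and it is unspecified
  if no such \<open>\<alpha>\<close> exists.\<close>

definition gen_rep_threshold :: "nat \<Rightarrow> nat \<Rightarrow> real" where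
  "gen_rep_threshold k l = (THE \<alpha>. is_gen_rep_threshold k l \<alpha>)"

end

theory Submission imports Defs begin

text \<open>
A repetition of period \<open>p\<close> and length \<open>p + e\<close> has order \<open>1 + e / p\<close>, so order \<open>3/2\<close> means \<open>2 * e = p\<close>.
Everything is therefore phrased with periods and excesses: \<open>repeats f i p e\<close> says that the \<open>e\<close>
letters of \<open>f\<close> from position \<open>i\<close> on occur again \<open>p\<close> positions later.

That no infinite ternary word is \<open>(3/2, 2)\<close>-free is a finite fact: the tree of ternary words without
a repetition of period \<open>p \<ge> 2\<close> and excess at least \<open>p / 2\<close> has height 30 and fewer than 6000 nodes,
and it is searched exhaustively (\<open>unavoidable_31\<close>).

The infinite \<open>((3/2)\<^sup>+, 2)\<close>-free ternary word is built in two stages. The \<open>source\<close> word is the fixed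
point of a 10-uniform morphism \<open>g\<close> on six letters, and all its repetitions satisfy the strict
inequality \<open>2 * e < p\<close>. The word \<open>ternary\<close> is the image of \<open>source\<close> under a 7-uniform morphism \<open>h\<close>,
and its repetitions of period at least 2 satisfy \<open>2 * e \<le> p\<close>.

Both bounds come from the same argument (\<open>repeats_desubstitute\<close>). Let \<open>v\<close> be the image of \<open>f\<close> under a
\<open>q\<close>-uniform morphism whose blocks occur in \<open>v\<close> only at multiples of \<open>q\<close>. A repetition of \<open>v\<close> with
excess at least \<open>2 * q - 1\<close> repeats a complete block, so its period is \<open>q * p\<close> and it comes from a
repetition of \<open>f\<close> of period \<open>p\<close> and some excess \<open>e\<close>; its own excess is at most \<open>q * e\<close> plus the
lengths of the common suffix and the common prefix that two different blocks can have.
The blocks of \<open>g\<close> begin with different letters and end with different letters, so nothing is lost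
and a long repetition in \<open>source\<close> with \<open>2 * e \<ge> p\<close> yields a shorter one of the same kind. Different
blocks of \<open>h\<close> share at most one letter at either end, and the loss of 2 is absorbed because
\<open>2 * e \<le> p - 1\<close> in \<open>source\<close> gives \<open>2 * (7 * e + 2) \<le> 7 * p - 3\<close>.

Repetitions of smaller excess lie inside bounded windows, and a window is determined by two
consecutive letters of \<open>source\<close>. Since \<open>g\<close> and \<open>h\<close> commute with cyclic shifts of the alphabets, few
windows remain to be inspected (\<open>source_window_check\<close>, \<open>ternary_window_check\<close>).
\<close>

section \<open>Repetitions as coinciding factors\<close>

definition repeats :: "(nat \<Rightarrow> 'a) \<Rightarrow> nat \<Rightarrow> nat \<Rightarrow> nat \<Rightarrow> bool" where
  "repeats f i p e \<longleftrightarrow> (\<forall>t<e. f (i + t) = f (i + t + p))"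

lemma repeats_mono: "repeats f i p e \<Longrightarrow> e' \<le> e \<Longrightarrow> repeats f i p e'"
  by (auto simp: repeats_def)

text \<open>For \<open>e \<le> p\<close> a single full period suffices: the repetition is \<open>x x'\<close> with \<open>length x = p\<close>.\<close>

lemma is_repetition_of_repeats:
  assumes "repeats f i p e" "0 < e" "e \<le> p"
  shows "is_repetition (1 + of_nat e / of_nat p) p (map f [i..<i + p + e])"
proof -
  have "map f [i..<i + p + e] = map f [i..<i + p] @ map f [i + p..<i + p + e]"
    by (metis le_add1 map_append upt_add_eq_append)
  moreover have "prefix (map f [i + p..<i + p + e]) (map f [i..<i + p])"
  proof -
    have "map f [i + p..<i + p + e] = take e (map f [i..<i + p])"
      using assms by (intro nth_equalityI) (auto simp: repeats_def ac_simps)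
    then show ?thesis by (simp add: take_is_prefix)
  qed
  moreover have "of_nat (length (map f [i..<i + p + e])) = (1 + of_nat e / of_nat p) * (of_nat p :: rat)"
    using assms by (simp add: field_simps)
  ultimately show ?thesis
    unfolding is_repetition_def using assms
    by (intro conjI exI[of _ "1 :: nat"] exI[of _ "map f [i..<i + p]"] exI[of _ "map f [i + p..<i + p + e]"]) auto
qed

lemma repeats_of_is_repetition:
  assumes "is_repetition \<alpha> p (map f [i..<j])"
  obtains e where "repeats f i p e" "of_nat (p + e) = \<alpha> * of_nat p" "\<alpha> > 1" "p \<ge> 1"
proof -
  let ?w = "map f [i..<j]"
  obtain n x x' where \<alpha>: "\<alpha> > 1" "p \<ge> 1" and n: "n \<ge> 1"
    and w: "?w = concat (replicate n x) @ x'"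
    and x': "prefix x' x" and x: "length x = p" and len: "of_nat (length ?w) = \<alpha> * of_nat (length x)"
    using assms unfolding is_repetition_def by blast
  \<comment> \<open>Removing the first \<open>x\<close> from the repetition leaves a word that is again a prefix of it.\<close>
  obtain m where m: "n = Suc m" using n by (cases n) auto
  define w' where "w' = concat (replicate m x) @ x'"
  have front: "?w = x @ w'" by (simp add: w m w'_def)
  have comm: "x @ concat (replicate m x) = concat (replicate m x) @ x"
    by (induction m) auto
  have "prefix w' (concat (replicate m x) @ x @ x')"
    unfolding w'_def using x' by (simp add: prefix_append prefix_def) (metis append_assoc)
  also have "concat (replicate m x) @ x @ x' = ?w"
    using comm by (simp add: w m)
  finally obtain z where z: "?w = w' @ z" by (auto simp: prefix_def)
  have lw: "length ?w = p + length w'" using front x by simp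
  have "repeats f i p (length w')"
    unfolding repeats_def
  proof (intro allI impI)
    fix t assume t: "t < length w'"
    have "?w ! (p + t) = ?w ! t" using t by (metis front z nth_append nth_append_length_plus x)
    then show "f (i + t) = f (i + t + p)" using t lw by (simp add: ac_simps)
  qed
  moreover have "of_nat (p + length w') = \<alpha> * of_nat p" using len lw x by simp
  ultimately show ?thesis using that \<alpha> by blast
qed

lemma rep_free_Inf_if:
  assumes "\<And>i p e. l \<le> p \<Longrightarrow> 0 < p \<Longrightarrow> repeats f i p e \<Longrightarrow> real (p + e) < \<alpha> * real p"
  shows "rep_free \<alpha> l (Inf f)"
  unfolding rep_free_def
proof (intro allI impI ballI notI)
  fix \<alpha>' p u
  assume ge: "\<alpha> \<le> of_rat \<alpha>'" and p: "l \<le> p" and u: "u \<in> factors (Inf f)" and rep: "is_repetition \<alpha>' p u"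
  obtain i j where "u = map f [i..<j]" using u by auto
  with rep obtain e where e: "repeats f i p e" "of_nat (p + e) = \<alpha>' * of_nat p" "p \<ge> 1"
    by (metis repeats_of_is_repetition)
  have "real (p + e) = of_rat (of_nat (p + e))" by (metis of_rat_of_nat_eq)
  also have "\<dots> = of_rat \<alpha>' * real p" unfolding e(2) by (simp add: of_rat_mult)
  also have "\<dots> \<ge> \<alpha> * real p" using ge by (simp add: mult_right_mono)
  finally show False using assms[OF p _ e(1)] e(3) by simp
qed

lemma rep_free_antimono: "rep_free \<alpha> l w \<Longrightarrow> \<alpha> \<le> \<beta> \<Longrightarrow> rep_free \<beta> l w"
  by (auto simp: rep_free_def)

lemma not_rep_free_Inf_if:
  assumes "repeats f i p e" "0 < e" "e \<le> p" "l \<le> p" "\<alpha> * real p \<le> real (p + e)"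
  shows "\<not> rep_free \<alpha> l (Inf f)"
proof
  assume "rep_free \<alpha> l (Inf f)"
  moreover have "map f [i..<i + p + e] \<in> factors (Inf f)" by auto
  moreover have "\<alpha> \<le> of_rat (1 + of_nat e / of_nat p)"
    using assms by (simp add: of_rat_add of_rat_divide field_simps)
  ultimately show False
    using is_repetition_of_repeats[OF assms(1-3)] assms(4) unfolding rep_free_def by blast
qed

section \<open>Executable search for repetitions in a finite word\<close>

fun agree_upto :: "nat \<Rightarrow> 'a list \<Rightarrow> 'a list \<Rightarrow> bool" where
  "agree_upto 0 xs ys = True"
| "agree_upto (Suc e) (x # xs) (y # ys) = (x = y \<and> agree_upto e xs ys)"
| "agree_upto (Suc e) _ _ = False"

lemma agree_upto_iff:
  "agree_upto e xs ys \<longleftrightarrow> e \<le> length xs \<and> e \<le> length ys \<and> (\<forall>t<e. xs ! t = ys ! t)"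
  by (induction e xs ys rule: agree_upto.induct) (auto simp: less_Suc_eq_0_disj)

fun agree_somewhere :: "nat \<Rightarrow> 'a list \<Rightarrow> 'a list \<Rightarrow> bool" where
  "agree_somewhere e (x # xs) (y # ys) = (agree_upto e (x # xs) (y # ys) \<or> agree_somewhere e xs ys)"
| "agree_somewhere e _ _ = False"

lemma agree_somewhereI:
  assumes "agree_upto e (drop i xs) (drop i ys)" "0 < e"
  shows "agree_somewhere e xs ys"
  using assms
proof (induction i arbitrary: xs ys)
  case 0
  then show ?case by (cases xs; cases ys) (auto simp: agree_upto_iff)
next
  case (Suc i)
  then show ?case by (cases xs; cases ys) (auto simp: agree_upto_iff[of e "[]"] agree_upto_iff[of e _ "[]"])
qed

text \<open>
The window \<open>W\<close> need only describe \<open>v\<close> up to a renaming \<open>\<pi>\<close> of the letters, since an injective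
renaming neither creates nor destroys repetitions. This is how the cyclic symmetry of the
morphisms reduces the number of windows.
\<close>

lemma not_repeats_in_window:
  assumes v: "\<And>t. t < length W \<Longrightarrow> v (m + t) = \<pi> (W ! t)" and inj: "inj_on \<pi> (set W)"
    and none: "\<not> agree_somewhere e W (drop p W)" and e: "0 < e" and fits: "r + p + e \<le> length W"
  shows "\<not> repeats v (m + r) p e"
proof
  assume rep: "repeats v (m + r) p e"
  have "W ! (r + t) = W ! (r + t + p)" if "t < e" for t
  proof -
    have "v (m + (r + t)) = v (m + (r + t + p))"
      using rep that by (simp add: repeats_def add.assoc)
    then have "\<pi> (W ! (r + t)) = \<pi> (W ! (r + t + p))"
      using that fits by (simp add: v)
    then show ?thesis
      using inj that fits by (simp add: inj_on_eq_iff)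
  qed
  moreover have "e \<le> length W - r" "e \<le> length W - (p + r)" using fits by linarith+
  ultimately have "agree_upto e (drop r W) (drop r (drop p W))"
    using fits by (simp add: agree_upto_iff ac_simps)
  then show False using none e agree_somewhereI by blast
qed

section \<open>Repetitions in images under uniform morphisms\<close>

definition uniform_image :: "nat \<Rightarrow> ('a \<Rightarrow> 'b list) \<Rightarrow> (nat \<Rightarrow> 'a) \<Rightarrow> (nat \<Rightarrow> 'b) \<Rightarrow> bool" where
  "uniform_image q g f v \<longleftrightarrow> (\<forall>a. length (g a) = q) \<and> (\<forall>n. v n = g (f (n div q)) ! (n mod q))"

lemma uniform_imageD:
  assumes "uniform_image q g f v"
  shows "length (g a) = q" "v n = g (f (n div q)) ! (n mod q)"
  using assms by (auto simp: uniform_image_def)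

lemma map_uniform_image:
  assumes v: "uniform_image q g f v"
  shows "map v [q * i..<q * j] = concat (map g (map f [i..<j]))"
proof (induction j)
  case (Suc j)
  show ?case
  proof (cases "i \<le> j")
    case True
    have "map v [q * j..<q * j + q] = g (f j)"
      by (rule nth_equalityI) (auto simp: uniform_imageD[OF v])
    moreover have "[q * i..<q * Suc j] = [q * i..<q * j] @ [q * j..<q * j + q]"
      using True by (metis add.commute mult_Suc_right mult_le_mono2 upt_add_eq_append)
    ultimately show ?thesis using True Suc by simp
  next
    case False
    then have "j < i" "q * Suc j \<le> q * i" by (simp_all del: mult_Suc_right)
    then show ?thesis by simp
  qed
qed simp

text \<open>
A long excess contains a complete block, which recurs one period later; by \<open>sync\<close> the period is then a
multiple \<open>q * p\<close>. Now compare block \<open>j\<close> with block \<open>j + p\<close>. If the repeated factor contains the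
first \<open>r + 1\<close> or the last \<open>l + 1\<close> letters of block \<open>j\<close>, then the two preimage letters agree. So the
factor sticks out of the blocks that are known to be repeated by at most \<open>l\<close> letters on the left and
\<open>r\<close> letters on the right.
\<close>

lemma repeats_desubstitute:
  fixes g :: "'a \<Rightarrow> 'b list"
  assumes image: "uniform_image q g f v"
    and sync: "\<And>i n. (\<forall>t<q. v (q * i + t) = v (n + t)) \<Longrightarrow> q dvd n"
    and pre: "\<And>i j. take (Suc r) (g (f i)) = take (Suc r) (g (f j)) \<Longrightarrow> f i = f j"
    and suf: "\<And>i j. drop (q - Suc l) (g (f i)) = drop (q - Suc l) (g (f j)) \<Longrightarrow> f i = f j"
    and r: "r < q" and l: "l < q"
    and rep: "repeats v i P E" and E: "2 * q - 1 \<le> E"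
  obtains p j e where "P = q * p" "repeats f j p e" "E \<le> q * e + (l + r)"
proof -
  note len = uniform_imageD(1)[OF image] and v = uniform_imageD(2)[OF image]
  have q: "0 < q" using r by simp
  have v': "v (q * k + s) = g (f k) ! s" if "s < q" for k s
    using that v[of "q * k + s"] by simp
  have rep': "v n = v (n + P)" if "i \<le> n" "n < i + E" for n
    using rep that unfolding repeats_def by (metis le_add_diff_inverse less_diff_conv2 add.commute)
  \<comment> \<open>\<open>k\<close> is the first block that starts at or after position \<open>i\<close>.\<close>
  define k where "k = (i + q - 1) div q"
  have k: "i \<le> q * k" "q * k < i + q"
  proof -
    have "(i + q - 1) mod q < q" using q by simp
    moreover have "q * k + (i + q - 1) mod q = i + q - 1" unfolding k_def by simp
    ultimately show "i \<le> q * k" "q * k < i + q" using q by linarith+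
  qed
  have "v (q * k + t) = v (q * k + P + t)" if "t < q" for t
    using rep'[of "q * k + t"] k E that by (simp add: ac_simps)
  then have "q dvd q * k + P" using sync by blast
  then obtain p where p: "P = q * p" by (metis dvd_add_right_iff dvd_triv_left dvdE)
  \<comment> \<open>Block \<open>j0\<close> is the first with more than \<open>l\<close> letters beyond position \<open>i\<close>, and \<open>j1\<close> is the first
    whose part before position \<open>i + E\<close> is no longer than \<open>r\<close>.\<close>
  define j0 where "j0 = (i + l) div q"
  define j1 where "j1 = (i + E - r + q - 1) div q"
  have j0: "i + l < q * j0 + q"
    unfolding j0_def using q by (metis add.commute dividend_less_times_div mult.commute)
  have j0': "q * j0 \<le> i + l" unfolding j0_def by simp
  have j1': "i + E - r \<le> q * j1"
  proof -
    have "(i + E - r + q - 1) mod q < q" using q by simp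
    moreover have "q * j1 + (i + E - r + q - 1) mod q = i + E - r + q - 1" unfolding j1_def by simp
    ultimately show ?thesis by linarith
  qed
  have j1: "q * j1 < i + E - r + q"
  proof -
    have "q * j1 \<le> i + E - r + q - 1" unfolding j1_def by simp
    then show ?thesis using q by linarith
  qed
  have eq: "f j = f (j + p)" if "j0 \<le> j" "j < j1" for j
  proof -
    have a: "i + l < q * j + q" using j0 that(1) by (meson add_le_mono1 mult_le_mono2 order_less_le_trans)
    have "q * Suc j \<le> q * j1" using that(2) by (metis Suc_leI mult_le_mono2)
    then have b: "q * j + r < i + E" using j1 E r by simp
    show ?thesis
    proof (cases "i \<le> q * j")
      case True
      have "g (f j) ! t = g (f (j + p)) ! t" if "t < Suc r" for t
        using rep'[of "q * j + t"] True b that r v'[of t j] v'[of t "j + p"] p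
        by (simp add: algebra_simps)
      then have "take (Suc r) (g (f j)) = take (Suc r) (g (f (j + p)))"
        by (intro nth_equalityI) (auto simp: len)
      then show ?thesis using pre by blast
    next
      case False
      have "g (f j) ! t = g (f (j + p)) ! t" if "q - Suc l \<le> t" "t < q" for t
        using rep'[of "q * j + t"] False a that l E v'[of t j] v'[of t "j + p"] p
        by (simp add: algebra_simps)
      then have "drop (q - Suc l) (g (f j)) = drop (q - Suc l) (g (f (j + p)))"
        by (intro nth_equalityI) (auto simp: len)
      then show ?thesis using suf by blast
    qed
  qed
  have "repeats f j0 p (j1 - j0)"
    unfolding repeats_def using eq by auto
  moreover have "E \<le> q * (j1 - j0) + (l + r)"
    using j0' j1' E r by (simp add: diff_mult_distrib2)
  ultimately show ?thesis using that p by blast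
qed

text \<open>
An occurrence of a block that is not aligned would lie in the interior of the concatenation of two
consecutive blocks, so over a finite alphabet alignment is a finite condition on triples of letters.
\<close>

lemma block_occurs_only_at_multiples:
  assumes image: "uniform_image q g f v"
    and inner: "\<And>i j k. 0 < k \<Longrightarrow> k < q \<Longrightarrow>
      \<not> agree_upto q (g (f i)) (drop k (g (f j) @ g (f (Suc j))))"
    and q: "0 < q" and occ: "\<forall>t<q. v (q * i + t) = v (n + t)"
  shows "q dvd n"
proof (rule ccontr)
  note len = uniform_imageD(1)[OF image] and v = uniform_imageD(2)[OF image]
  define j k where "j = n div q" and "k = n mod q"
  assume "\<not> q dvd n"
  then have k: "0 < k" "k < q" using q by (auto simp: k_def mod_greater_zero_iff_not_dvd)
  have n: "n = q * j + k" by (simp add: j_def k_def)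
  have "g (f i) ! t = (g (f j) @ g (f (Suc j))) ! (k + t)" if t: "t < q" for t
  proof -
    have "g (f i) ! t = v (n + t)" using occ t v[of "q * i + t"] by simp
    also have "\<dots> = (g (f j) @ g (f (Suc j))) ! (k + t)"
    proof (cases "k + t < q")
      case True
      then show ?thesis using v[of "q * j + (k + t)"] by (simp add: n nth_append len add.assoc)
    next
      case False
      define s where "s = k + t - q"
      have s: "k + t = q + s" "s < q" using False k t by (auto simp: s_def)
      then have "n + t = q * Suc j + s" by (simp add: n add.assoc)
      then show ?thesis using v[of "q * Suc j + s"] s
        by (simp add: nth_append len del: mult_Suc_right)
    qed
    finally show ?thesis .
  qed
  then have "agree_upto q (g (f i)) (drop k (g (f j) @ g (f (Suc j))))"
    using k by (simp add: agree_upto_iff len del: drop_append)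
  then show False using inner k by blast
qed

section \<open>A word on six letters with all repetitions of order less than 3/2\<close>

text \<open>
The letters are the residues modulo 6, and the block of \<open>a\<close> is the block of \<open>0\<close> shifted by \<open>a\<close>. Hence
the blocks have pairwise different first letters and pairwise different last letters, whatever the
seed is; this seed was found by computer search.
\<close>

definition seed :: "nat list" where
  "seed = [0, 1, 3, 5, 1, 2, 3, 1, 5, 0]"

definition g :: "nat \<Rightarrow> nat list" where
  "g a = map (\<lambda>x. (x + a) mod 6) seed"

lemma length_seed [simp]: "length seed = 10" by (simp add: seed_def)

lemma length_g [simp]: "length (g a) = 10" by (simp add: g_def)

lemma g_add: "g ((x + c) mod 6) = map (\<lambda>y. (y + c) mod 6) (g x)"
  by (simp add: g_def mod_simps ac_simps)

fun source :: "nat \<Rightarrow> nat" where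
  "source n = (if n = 0 then 0 else g (source (n div 10)) ! (n mod 10))"

declare source.simps [simp del]

lemma source_eq: "source n = g (source (n div 10)) ! (n mod 10)"
  by (cases "n = 0") (simp_all add: source.simps[of 0] source.simps[of n] g_def seed_def)

lemma source_image: "uniform_image 10 g source source"
  unfolding uniform_image_def by (intro conjI allI length_g source_eq)

lemma source_less: "source n < 6"
  by (subst source_eq) (simp add: g_def)

text \<open>
These are the differences modulo 6 between consecutive letters of \<open>source\<close>. The seed begins and ends
with 0, so the difference at the boundary of two blocks is the difference of their preimages, and no
differences arise beyond those inside the seed.
\<close>

definition steps :: "nat list" where
  "steps = [1, 2, 4]"

lemma source_step: "\<exists>d\<in>set steps. source (Suc n) = (source n + d) mod 6"
proof (induction n rule: less_induct)
  case (less n)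
  define a where "a = source (n div 10)"
  show ?case
  proof (cases "n mod 10 = 9")
    case True
    have "source n = a"
      using True source_less[of "n div 10"] by (simp add: source_eq[of n] a_def g_def seed_def)
    moreover have "Suc n mod 10 = 0" "Suc n div 10 = Suc (n div 10)"
      using True by (simp_all add: mod_Suc div_Suc)
    then have "source (Suc n) = source (Suc (n div 10))"
      using source_less[of "Suc (n div 10)"] by (simp add: source_eq[of "Suc n"] g_def seed_def)
    moreover have "n div 10 < n" using True by (cases n) auto
    ultimately show ?thesis using less a_def by metis
  next
    case False
    define r where "r = n mod 10"
    have r: "r < 9" using False mod_less_divisor[of 10 n] unfolding r_def by linarith
    have "Suc n mod 10 = Suc r" "Suc n div 10 = n div 10"
      using False by (simp_all add: r_def mod_Suc div_Suc)
    then have n: "source (Suc n) = (seed ! Suc r + a) mod 6" "source n = (seed ! r + a) mod 6"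
      using r by (simp_all add: source_eq[of "Suc n"] source_eq[of n] a_def g_def flip: r_def)
    have "\<forall>r\<in>set [0..<9]. \<exists>d\<in>set steps. seed ! Suc r = (seed ! r + d) mod 6"
      by code_simp
    moreover have "r \<in> set [0..<9]" using r by simp
    ultimately obtain d where "d \<in> set steps" "seed ! Suc r = (seed ! r + d) mod 6"
      by blast
    with n show ?thesis by (auto simp: mod_simps ac_simps)
  qed
qed

lemma source_inner: "\<forall>a\<in>set [0..<6]. \<forall>b\<in>set [0..<6]. \<forall>d\<in>set steps. \<forall>k\<in>set [1..<10].
    \<not> agree_upto 10 (g a) (drop k (g b @ g ((b + d) mod 6)))"
  by code_simp

text \<open>
A repetition of period at most 36 and excess \<open>(p + 1) div 2\<close> has length at most 54, so it fits into
200 consecutive letters whenever it starts among the first 100 of them. Such a stretch, if it starts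
at a multiple of 100, is the image under \<open>g \<circ> g\<close> of two consecutive letters, and by symmetry the
first of them may be taken to be 0.
\<close>

definition source_window :: "nat \<Rightarrow> nat list" where
  "source_window d = concat (map g (concat (map g [0, d])))"

lemma source_window_check: "\<forall>d\<in>set steps. let W = source_window d in
    \<forall>p\<in>set [1..<37]. \<not> agree_somewhere ((p + 1) div 2) W (drop p W)"
  by code_simp

lemma length_source_window [simp]: "length (source_window d) = 200"
  by (simp add: source_window_def length_concat o_def sum_list_triv)

lemma source_window_less: "set (source_window d) \<subseteq> {..<6}"
  by (auto simp: source_window_def g_def)

lemma inj_on_add_mod: "inj_on (\<lambda>x. (x + c) mod n) {..<n::nat}"
proof (rule linorder_inj_onI)
  fix x y assume xy: "x < y" "x \<in> {..<n}" "y \<in> {..<n}"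
  then have "\<not> n dvd (y + c) - (x + c)" by (simp add: nat_dvd_not_less)
  then show "(x + c) mod n \<noteq> (y + c) mod n"
    using xy(1) mod_eq_dvd_iff_nat[of "x + c" "y + c" n] by auto
qed auto

lemma map_source_blocks: "map source [10 * i..<10 * j] = concat (map g (map source [i..<j]))"
  using source_image by (rule map_uniform_image)

lemma concat_map_g_add:
  "concat (map g (map (\<lambda>y. (y + c) mod 6) xs)) = map (\<lambda>y. (y + c) mod 6) (concat (map g xs))"
  by (induction xs) (simp_all add: g_add)

lemma source_pair:
  obtains d where "d \<in> set steps" "\<And>c x. source k = (x + c) mod 6 \<Longrightarrow>
    map source [k..<k + 2] = map (\<lambda>y. (y + c) mod 6) [x, x + d]"
proof -
  obtain d where "d \<in> set steps" "source (Suc k) = (source k + d) mod 6"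
    using source_step by blast
  then show ?thesis by (intro that[of d]) (auto simp: mod_simps ac_simps numeral_2_eq_2)
qed

lemma source_no_short_repetition:
  assumes rep: "repeats source i p e" and p: "0 < p" "p \<le> 36" and pe: "p \<le> 2 * e"
  shows False
proof -
  define k r where "k = i div 100" and "r = i mod 100"
  have i: "i = 100 * k + r" "r < 100" by (simp_all add: k_def r_def)
  let ?s = "\<lambda>y. (y + source k) mod 6"
  obtain d where d: "d \<in> set steps" and pair: "map source [k..<k + 2] = map ?s [0, d]"
    using source_pair[of k] source_less[of k] by (metis add_0 mod_less)
  have "map source [10 * (10 * k)..<10 * (10 * (k + 2))] = map ?s (source_window d)"
    unfolding map_source_blocks pair concat_map_g_add source_window_def ..
  then have W: "map source [100 * k..<100 * k + 200] = map ?s (source_window d)"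
    by (simp add: add.commute)
  have "source (100 * k + t) = ?s (source_window d ! t)" if "t < length (source_window d)" for t
    using arg_cong[OF W, of "\<lambda>xs. xs ! t"] that by simp
  moreover have "inj_on ?s (set (source_window d))"
    by (rule inj_on_subset[OF inj_on_add_mod source_window_less])
  moreover have "\<not> agree_somewhere ((p + 1) div 2) (source_window d) (drop p (source_window d))"
    using source_window_check d p unfolding Let_def Ball_def set_upt by simp
  moreover have "r + p + (p + 1) div 2 \<le> length (source_window d)"
    using i p by simp
  ultimately have "\<not> repeats source (100 * k + r) p ((p + 1) div 2)"
    using p by (intro not_repeats_in_window) auto
  moreover have "repeats source i p ((p + 1) div 2)"
    using rep by (rule repeats_mono) (use pe in simp)
  ultimately show False using i by simp
qed

text \<open>
Induction on the period. An excess below 19 that violates the bound forces a period of at most 36,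
which the windows exclude; a larger excess desubstitutes without loss to a repetition with a tenth
of the period.
\<close>

lemma source_repetition_less:
  assumes "repeats source i p e" "0 < p"
  shows "2 * e < p"
  using assms
proof (induction p arbitrary: i e rule: less_induct)
  case (less P)
  show ?case
  proof (rule ccontr)
    assume not: "\<not> 2 * e < P"
    show False
    proof (cases "2 * 10 - 1 \<le> e")
      case False
      then show ?thesis using source_no_short_repetition[OF less.prems] not by linarith
    next
      case True
      have inj: "a = b" if "a < 6" "b < 6" "take 1 (g a) = take 1 (g b) \<or> drop 9 (g a) = drop 9 (g b)" for a b
      proof -
        have "\<forall>a\<in>set [0..<6]. \<forall>b\<in>set [0..<6].
          take 1 (g a) = take 1 (g b) \<or> drop 9 (g a) = drop 9 (g b) \<longrightarrow> a = b"
          by code_simp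
        then show ?thesis using that by auto
      qed
      have sync: "10 dvd n" if "\<forall>t<10. source (10 * i + t) = source (n + t)" for i n
      proof (rule block_occurs_only_at_multiples[OF source_image _ _ that])
        show "\<not> agree_upto 10 (g (source i)) (drop k (g (source j) @ g (source (Suc j))))"
          if "0 < k" "k < 10" for i j k
        proof -
          obtain d where "d \<in> set steps" "source (Suc j) = (source j + d) mod 6"
            using source_step by blast
          then show ?thesis using source_inner source_less[of i] source_less[of j] that by auto
        qed
      qed simp
      obtain p j e' where *: "P = 10 * p" "repeats source j p e'" "e \<le> 10 * e' + (0 + 0)"
      proof (rule repeats_desubstitute[OF source_image sync _ _ _ _ less.prems(1) True, where r = 0 and l = 0])
        show "source i = source j" if "take (Suc 0) (g (source i)) = take (Suc 0) (g (source j))" for i j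
          using inj source_less that by simp
        show "source i = source j"
          if "drop (10 - Suc 0) (g (source i)) = drop (10 - Suc 0) (g (source j))" for i j
          using inj source_less that by simp
      qed auto
      then have "2 * e' < p" using less.IH[of p j e'] less.prems(2) by simp
      then show False using * not by simp
    qed
  qed
qed

section \<open>The ternary image\<close>

text \<open>
Adding 2 to a letter modulo 6 adds 1 to every letter of its block modulo 3, so the two explicit
blocks, again found by computer search, determine the others.
\<close>

definition h :: "nat \<Rightarrow> nat list" where
  "h a = map (\<lambda>x. (x + a div 2) mod 3) (if even a then [0, 0, 1, 0, 2, 0, 1] else [1, 2, 0, 0, 0, 2, 1])"

lemma length_h [simp]: "length (h a) = 7" by (simp add: h_def)

lemma h_add: "h ((x + 2 * c) mod 6) = map (\<lambda>y. (y + c) mod 3) (h x)"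
proof -
  have "(x + 2 * c) mod 6 div 2 = (x div 2 + c) mod 3"
    using mod_mult2_eq[of "x + 2 * c" 2 3] by (simp add: ac_simps)
  moreover have "even ((x + 2 * c) mod 6) = even x"
    by (simp add: dvd_mod_iff)
  ultimately show ?thesis by (simp add: h_def mod_simps ac_simps)
qed

definition ternary :: "nat \<Rightarrow> nat" where
  "ternary n = h (source (n div 7)) ! (n mod 7)"

lemma ternary_image: "uniform_image 7 h source ternary"
  by (simp add: uniform_image_def ternary_def)

lemma ternary_less: "ternary n < 3"
proof -
  have "set (h a) \<subseteq> {..<3}" for a by (auto simp: h_def)
  moreover have "ternary n \<in> set (h (source (n div 7)))" by (simp add: ternary_def)
  ultimately show ?thesis by blast
qed

lemma ternary_inner: "\<forall>a\<in>set [0..<6]. \<forall>b\<in>set [0..<6]. \<forall>d\<in>set steps. \<forall>k\<in>set [1..<7].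
    \<not> agree_upto 7 (h a) (drop k (h b @ h ((b + d) mod 6)))"
  by code_simp

text \<open>
A repetition of period at most 23 and excess \<open>p div 2 + 1\<close> has length at most 35, so it fits into 140
letters whenever it starts among the first 70. The symmetry of \<open>h\<close> leaves two choices for the
first of the two letters of \<open>source\<close> that determine the window. The second letter \<open>a + d\<close> is at most 5.
\<close>

definition ternary_window :: "nat \<Rightarrow> nat \<Rightarrow> nat list" where
  "ternary_window a d = concat (map h (concat (map g [a, a + d])))"

lemma ternary_window_check: "\<forall>a\<in>set [0, 1]. \<forall>d\<in>set steps. let W = ternary_window a d in
    \<forall>p\<in>set [2..<24]. \<not> agree_somewhere (p div 2 + 1) W (drop p W)"
  by code_simp

lemma length_ternary_window [simp]: "length (ternary_window a d) = 140"
  by (simp add: ternary_window_def length_concat o_def sum_list_triv)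

lemma ternary_window_less: "set (ternary_window a d) \<subseteq> {..<3}"
  by (auto simp: ternary_window_def h_def split: if_splits)

lemma concat_map_h_add:
  "concat (map h (map (\<lambda>y. (y + 2 * c) mod 6) xs)) = map (\<lambda>y. (y + c) mod 3) (concat (map h xs))"
  by (induction xs) (simp_all add: h_add)

lemma ternary_no_short_repetition:
  assumes rep: "repeats ternary i p e" and p: "2 \<le> p" "p \<le> 23" and pe: "p < 2 * e"
  shows False
proof -
  define k r where "k = i div 70" and "r = i mod 70"
  have i: "i = 70 * k + r" "r < 70" by (simp_all add: k_def r_def)
  define a c where "a = source k mod 2" and "c = source k div 2"
  have ac: "source k = (a + 2 * c) mod 6" using source_less[of k] by (simp add: a_def c_def)
  have a: "a \<in> set [0, 1]" by (auto simp: a_def)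
  obtain d where d: "d \<in> set steps"
    and pair: "map source [k..<k + 2] = map (\<lambda>y. (y + 2 * c) mod 6) [a, a + d]"
    using source_pair[of k] ac by metis
  let ?W = "ternary_window a d" and ?s = "\<lambda>y. (y + c) mod 3"
  have "map ternary [7 * (10 * k)..<7 * (10 * (k + 2))] = map ?s ?W"
    unfolding map_uniform_image[OF ternary_image] map_source_blocks pair
      concat_map_g_add concat_map_h_add ternary_window_def ..
  then have W: "map ternary [70 * k..<70 * k + 140] = map ?s ?W"
    by (simp add: add.commute)
  have "ternary (70 * k + t) = ?s (?W ! t)" if "t < length ?W" for t
    using arg_cong[OF W, of "\<lambda>xs. xs ! t"] that by simp
  moreover have "inj_on ?s (set ?W)"
    by (rule inj_on_subset[OF inj_on_add_mod ternary_window_less])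
  moreover have "\<not> agree_somewhere (p div 2 + 1) ?W (drop p ?W)"
  proof -
    have "p \<in> set [2..<24]" using p unfolding set_upt by simp
    then show ?thesis using ternary_window_check a d unfolding Let_def by blast
  qed
  moreover have "r + p + (p div 2 + 1) \<le> length ?W"
    using i p by simp
  ultimately have "\<not> repeats ternary (70 * k + r) p (p div 2 + 1)"
    by (intro not_repeats_in_window) auto
  moreover have "repeats ternary i p (p div 2 + 1)"
    using rep by (rule repeats_mono) (use pe in simp)
  ultimately show False using i by simp
qed

lemma ternary_repetition_le:
  assumes rep: "repeats ternary i P e" and P: "2 \<le> P"
  shows "2 * e \<le> P"
proof (rule ccontr)
  assume not: "\<not> 2 * e \<le> P"
  show False
  proof (cases "2 * 7 - 1 \<le> e")
    case False
    then show ?thesis using ternary_no_short_repetition[OF rep P] not by linarith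
  next
    case True
    have inj: "a = b" if "a < 6" "b < 6" "take 2 (h a) = take 2 (h b) \<or> drop 5 (h a) = drop 5 (h b)" for a b
    proof -
      have "\<forall>a\<in>set [0..<6]. \<forall>b\<in>set [0..<6].
        take 2 (h a) = take 2 (h b) \<or> drop 5 (h a) = drop 5 (h b) \<longrightarrow> a = b"
        by code_simp
      then show ?thesis using that by auto
    qed
    have sync: "7 dvd n" if "\<forall>t<7. ternary (7 * i + t) = ternary (n + t)" for i n
    proof (rule block_occurs_only_at_multiples[OF ternary_image _ _ that])
      show "\<not> agree_upto 7 (h (source i)) (drop k (h (source j) @ h (source (Suc j))))"
        if "0 < k" "k < 7" for i j k
      proof -
        obtain d where "d \<in> set steps" "source (Suc j) = (source j + d) mod 6"
          using source_step by blast
        then show ?thesis using ternary_inner source_less[of i] source_less[of j] that by auto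
      qed
    qed simp
    obtain p j e' where *: "P = 7 * p" "repeats source j p e'" "e \<le> 7 * e' + (1 + 1)"
    proof (rule repeats_desubstitute[OF ternary_image sync _ _ _ _ rep True, where r = 1 and l = 1])
      show "source i = source j" if "take (Suc 1) (h (source i)) = take (Suc 1) (h (source j))" for i j
        using inj source_less that by (simp add: numeral_2_eq_2)
      show "source i = source j"
        if "drop (7 - Suc 1) (h (source i)) = drop (7 - Suc 1) (h (source j))" for i j
        using inj source_less that by simp
    qed auto
    then have "2 * e' < p" using source_repetition_less P by simp
    then show False using * not by simp
  qed
qed

lemma rep_free_plus_ternary: "rep_free_plus (3 / 2) 2 (Inf ternary)"
  unfolding rep_free_plus_def
proof (intro allI impI rep_free_Inf_if)
  fix \<alpha> :: real and i p e :: nat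
  assume \<alpha>: "3 / 2 < \<alpha>" and p: "2 \<le> p" "0 < p" and "repeats ternary i p e"
  then have "2 * e \<le> p" using ternary_repetition_le by blast
  then have "real (p + e) \<le> 3 / 2 * real p" by simp
  also have "\<dots> < \<alpha> * real p" using \<alpha> p by simp
  finally show "real (p + e) < \<alpha> * real p" .
qed

section \<open>Unavoidability over three letters\<close>

text \<open>
Words are built by prepending letters, so \<open>w\<close> is read backwards and only repetitions at its newest end
have to be detected. The argument \<open>e\<close> of \<open>forbidden_from\<close> serves the two periods \<open>2 * e - 1\<close> and
\<open>2 * e\<close>, for which it is the least excess of order at least 3/2; the last argument is \<open>w\<close> without
its first \<open>2 * e - 1\<close> letters. Period 1 is exempt, so \<open>forbidden\<close> treats period 2 separately and lets
\<open>e\<close> start at 2.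
\<close>

fun forbidden_from :: "nat \<Rightarrow> 'a list \<Rightarrow> 'a list \<Rightarrow> bool" where
  "forbidden_from e w [] = False"
| "forbidden_from e w (y # ys) =
    (agree_upto e w (y # ys) \<or> agree_upto e w ys \<or> forbidden_from (Suc e) w (tl ys))"

definition forbidden :: "'a list \<Rightarrow> bool" where
  "forbidden w = (agree_upto 1 w (drop 2 w) \<or> forbidden_from 2 w (drop 3 w))"

fun unavoidable :: "nat \<Rightarrow> nat list \<Rightarrow> bool" where
  "unavoidable 0 w = forbidden w"
| "unavoidable (Suc n) w = (forbidden w \<or> (\<forall>c\<in>set [0, 1, 2]. unavoidable n (c # w)))"

lemma forbidden_from_repetition:
  assumes "forbidden_from e w (drop (2 * e - 1) w)" "2 \<le> e"
  shows "\<exists>p\<ge>2. agree_upto ((p + 1) div 2) w (drop p w)"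
  using assms
proof (induction e w "drop (2 * e - 1) w" rule: forbidden_from.induct)
  case (2 e w y ys)
  have ys: "ys = drop (2 * e) w"
    using 2(2) 2(4) by (metis Suc_diff_1 drop_Suc list.sel(3) mult_2 tl_drop trans_le_add1 zero_less_numeral order_less_le_trans)
  have tl: "tl ys = drop (2 * Suc e - 1) w"
    by (simp add: ys tl_drop flip: drop_Suc)
  consider "agree_upto e w (drop (2 * e - 1) w)" | "agree_upto e w (drop (2 * e) w)"
    | "forbidden_from (Suc e) w (tl ys)"
    using 2(3) unfolding 2(2)[symmetric] ys by auto
  then show ?case
  proof cases
    case 1
    then show ?thesis using 2(4) by (intro exI[of _ "2 * e - 1"]) auto
  next
    case 2
    then show ?thesis using \<open>2 \<le> e\<close> by (intro exI[of _ "2 * e"]) auto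
  next
    case 3
    then show ?thesis using 2(1)[OF tl] 2(4) tl by simp
  qed
qed simp

lemma forbidden_repetition:
  assumes "forbidden w"
  shows "\<exists>p\<ge>2. agree_upto ((p + 1) div 2) w (drop p w)"
proof (cases "agree_upto 1 w (drop 2 w)")
  case True
  then show ?thesis by (intro exI[of _ 2]) simp
next
  case False
  then show ?thesis using assms forbidden_from_repetition[of 2 w] by (simp add: forbidden_def)
qed

lemma forbidden_rev_prefix:
  assumes "forbidden (rev (map f [0..<m]))"
  shows "\<exists>i p. 2 \<le> p \<and> repeats f i p ((p + 1) div 2)"
proof -
  let ?w = "rev (map f [0..<m])"
  obtain p where p: "2 \<le> p" and agree: "agree_upto ((p + 1) div 2) ?w (drop p ?w)"
    using forbidden_repetition[OF assms] by blast
  define e where "e = (p + 1) div 2"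
  have e: "0 < e" "e + p \<le> m" using agree p by (auto simp: agree_upto_iff e_def)
  have "f (m - p - e + t) = f (m - p - e + t + p)" if "t < e" for t
  proof -
    define s where "s = e - 1 - t"
    have s: "s < e" "m - Suc s = m - p - e + t + p" "m - Suc (p + s) = m - p - e + t"
      using e that by (auto simp: s_def)
    have "?w ! s = ?w ! (p + s)"
      using agree s(1) e unfolding agree_upto_iff e_def[symmetric] by simp
    moreover have "?w ! s = f (m - Suc s)" "?w ! (p + s) = f (m - Suc (p + s))"
      using e s(1) by (simp_all add: rev_nth)
    ultimately show ?thesis using s by simp
  qed
  then show ?thesis using p unfolding repeats_def e_def by blast
qed

lemma unavoidable_repetition:
  assumes "unavoidable n (rev (map f [0..<m]))" "range f \<subseteq> {..<3}"
  shows "\<exists>i p. 2 \<le> p \<and> repeats f i p ((p + 1) div 2)"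
  using assms
proof (induction n arbitrary: m)
  case (Suc n)
  show ?case
  proof (cases "forbidden (rev (map f [0..<m]))")
    case False
    have "f m < 3" using Suc.prems(2) by auto
    then have "f m \<in> set [0, 1, 2]" by auto
    then have "unavoidable n (rev (map f [0..<Suc m]))" using False Suc.prems(1) by auto
    then show ?thesis using Suc by blast
  qed (use Suc forbidden_rev_prefix in auto)
qed (use forbidden_rev_prefix in auto)

lemma unavoidable_31: "unavoidable 31 []"
  by code_simp

lemma not_rep_free_three_letters:
  fixes f :: "nat \<Rightarrow> nat"
  assumes "range f \<subseteq> {..<3}"
  shows "\<not> rep_free (3 / 2) 2 (Inf f)"
proof -
  obtain i p where p: "2 \<le> p" and rep: "repeats f i p ((p + 1) div 2)"
    using unavoidable_repetition[of 31 f 0] unavoidable_31 assms by auto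
  have "p \<le> 2 * ((p + 1) div 2)" by simp
  then have "3 / 2 * real p \<le> real (p + (p + 1) div 2)" by linarith
  then show ?thesis using rep p by (intro not_rep_free_Inf_if[of f i p]) auto
qed

section \<open>The threshold\<close>

theorem theorem4:
  shows "is_gen_rep_threshold 3 2 (3/2) \<and> gen_rep_threshold 3 2 = 3/2"
proof -
  let ?v = "Inf ternary :: nat word"
  have v: "?v \<in> words_over 3" "is_Inf ?v" using ternary_less by (auto simp: words_over_def)
  have v_free: "rep_free \<alpha> 2 ?v" if "3 / 2 < \<alpha>" for \<alpha>
    using rep_free_plus_ternary that by (simp add: rep_free_plus_def)
  have fin: "is_Fin w" if "w \<in> words_over 3" "rep_free (3 / 2) 2 w" for w
    using that not_rep_free_three_letters by (cases w) (auto simp: words_over_def)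
  have threshold: "is_gen_rep_threshold 3 2 (3/2)"
    unfolding is_gen_rep_threshold_def using v fin rep_free_plus_ternary by blast
  have inf: "\<not> is_Fin w" if "is_Inf w" for w :: "nat word" using that by (cases w) auto
  have "\<beta> = 3/2" if \<beta>: "is_gen_rep_threshold 3 2 \<beta>" for \<beta>
  proof (rule linorder_cases[of \<beta> "3/2"])
    assume less: "\<beta> < 3/2"
    obtain w where "w \<in> words_over 3" "is_Inf w" "rep_free_plus \<beta> 2 w \<or> rep_free \<beta> 2 w"
      using \<beta> unfolding is_gen_rep_threshold_def by blast
    moreover from this have "rep_free (3/2) 2 w"
      using less rep_free_antimono[of \<beta> 2 w "3/2"] by (auto simp: rep_free_plus_def)
    ultimately show ?thesis using fin inf by blast
  next
    assume greater: "3/2 < \<beta>"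
    define \<epsilon> where "\<epsilon> = (\<beta> - 3/2) / 2"
    have \<epsilon>: "0 < \<epsilon>" "3/2 < \<beta> - \<epsilon>" using greater by (simp_all add: \<epsilon>_def field_simps)
    have "rep_free \<beta> 2 ?v" "rep_free (\<beta> - \<epsilon>) 2 ?v" using v_free greater \<epsilon> by blast+
    then show ?thesis
      using \<beta> v inf \<epsilon>(1) unfolding is_gen_rep_threshold_def by blast
  qed
  then have "gen_rep_threshold 3 2 = 3/2"
    unfolding gen_rep_threshold_def using threshold by (intro the_equality)
  with threshold show ?thesis ..
qed

end
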